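(* Let $G$ be a simple graph with vertex set $V=\{v_1,\ldots,v_n\}$ and let $F$ be a facet of the edge cone $\mathbb{R}_+\mathcal{A}$ of $G$. Then either (a) $F=\mathbb{R}_+\mathcal{A}\cap\{x\in\mathbb{R}^n\mid x_i=0\}$ for some $1\le i\le n$, or (b) $F=\mathbb{R}_+\mathcal{A}\cap H_A$ for some independent set $A$ of $G$.
   Context: $e_i$ is the $i$-th unit vector of $\mathbb{R}^n$. The edge cone $\mathbb{R}_+\mathcal{A}$ is the cone of nonnegative real combinations of the vectors $e_i+e_j$ with $\{v_i,v_j\}$ an edge of $G$. A set of vertices is independent if no two of its vertices are adjacent; $N(A)$ is the set of vertices adjacent to some vertex of $A$; $H_A=\{x\in\mathbb{R}^n\mid\sum_{v_i\in A}x_i=\sum_{v_i\in N(A)}x_i\}$. A face of a cone $Q$ is $Q\cap H$ for a hyperplane $H$ through the origin with $Q$ on one side of $H$; a facet is a face of dimension $\dim Q-1$ (dimension of the affine hull). *)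

theory Defs
  imports "HOL-Analysis.Analysis"
begin

text \<open>
  The vertices \<open>v\<^sub>1, \<dots>, v\<^sub>n\<close> are the elements of an arbitrary finite type \<open>'n\<close>, so that
  \<open>\<real>\<^sup>n\<close> is \<open>real ^ 'n\<close> and \<open>e\<^sub>i\<close> is \<open>axis i 1\<close>. A graph is given by its set of edges, each an
  unordered pair of distinct vertices.
\<close>

definition simple_graph :: "'n set set \<Rightarrow> bool" where
  "simple_graph E \<longleftrightarrow> (\<forall>e\<in>E. card e = 2)"

definition edge_vectors :: "'n::finite set set \<Rightarrow> (real ^ 'n) set" where
  "edge_vectors E = {axis i 1 + axis j 1 | i j. {i, j} \<in> E}"

definition edge_cone :: "'n::finite set set \<Rightarrow> (real ^ 'n) set" where
  "edge_cone E = {\<Sum>a\<in>edge_vectors E. c a *\<^sub>R a | c. \<forall>a\<in>edge_vectors E. 0 \<le> c a}"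

definition independent_vertices :: "'n set set \<Rightarrow> 'n set \<Rightarrow> bool" where
  "independent_vertices E A \<longleftrightarrow> (\<forall>u\<in>A. \<forall>v\<in>A. {u, v} \<notin> E)"

definition neighbours :: "'n set set \<Rightarrow> 'n set \<Rightarrow> 'n set" where
  "neighbours E A = {v. \<exists>u\<in>A. {u, v} \<in> E}"

definition H_set :: "'n::finite set set \<Rightarrow> 'n set \<Rightarrow> (real ^ 'n) set" where
  "H_set E A = {x. (\<Sum>i\<in>A. x $ i) = (\<Sum>i\<in>neighbours E A. x $ i)}"

text \<open>
  A hyperplane through the origin has a nonzero normal vector \<open>a\<close>, whose sign can be chosen so that
  the cone lies on the side \<open>0 \<le> a \<bullet> x\<close>. The library's \<^const>\<open>face_of\<close> and \<^const>\<open>facet_of\<close>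
  are not defined through supporting hyperplanes, and \<^const>\<open>exposed_face_of\<close> also allows
  \<open>a = 0\<close> and hyperplanes not through the origin.
\<close>

definition cone_face :: "'a::euclidean_space set \<Rightarrow> 'a set \<Rightarrow> bool" where
  "cone_face Q F \<longleftrightarrow> (\<exists>a. a \<noteq> 0 \<and> Q \<subseteq> {x. 0 \<le> a \<bullet> x} \<and> F = Q \<inter> {x. a \<bullet> x = 0})"

definition cone_facet :: "'a::euclidean_space set \<Rightarrow> 'a set \<Rightarrow> bool" where
  "cone_facet Q F \<longleftrightarrow> cone_face Q F \<and> aff_dim F = aff_dim Q - 1"

lemma finite_edge_vectors: "finite (edge_vectors E)"
proof -
  have "edge_vectors E \<subseteq> (\<lambda>(i, j). axis i 1 + axis j 1) ` UNIV"
    by (auto simp: edge_vectors_def)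
  then show ?thesis
    by (rule finite_subset) simp
qed

end

theory Submission
  imports Defs
begin

text \<open>
  Write \<open>F\<close> as the zero set on the cone of a functional \<open>a\<close> that is nonnegative on all edges. Since
  \<open>F\<close> has codimension one, any other functional that vanishes on \<open>F\<close> but not on the whole cone
  also cuts out \<open>F\<close>. Choose an edge \<open>{p, q}\<close> with \<open>a\<^sub>p + a\<^sub>q > 0\<close> and \<open>a\<^sub>q > 0\<close>, and let
  \<open>A\<close> be the set of vertices \<open>i\<close> with \<open>a\<^sub>i \<le> - a\<^sub>q\<close>. Then \<open>A\<close> is independent. If no neighbour of \<open>q\<close>
  lies in \<open>A\<close>, no edge of \<open>F\<close> contains \<open>q\<close> and the coordinate \<open>x\<^sub>q\<close> vanishes on \<open>F\<close>. Otherwise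
  \<open>q\<close> is in \<open>N(A)\<close> while \<open>p\<close> is not in \<open>A\<close>, so the functional defining \<open>H\<^sub>A\<close> is nonzero on the edge
  \<open>{p, q}\<close>; it vanishes on \<open>F\<close> because each edge of \<open>F\<close> joins vertices of opposite weights.
\<close>

text \<open>The section \<open>G\<close> by \<open>b\<close> contains \<open>F\<close>, and its
  affine hull misses \<open>w\<close>, so its dimension is below that of \<open>Q\<close>. Hence
  \<open>F\<close> and \<open>G\<close> share their affine hull, on which \<open>a\<close>
  vanishes.\<close>

lemma hyperplane_section_eqI:
  fixes a b w :: "'a::euclidean_space"
  assumes F: "F = Q \<inter> {x. a \<bullet> x = 0}" and dim: "aff_dim F = aff_dim Q - 1"
    and vanish: "\<And>x. x \<in> F \<Longrightarrow> b \<bullet> x = 0"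
    and w: "w \<in> Q" "b \<bullet> w \<noteq> 0"
  shows "F = Q \<inter> {x. b \<bullet> x = 0}"
proof -
  define G where "G = Q \<inter> {x. b \<bullet> x = 0}"
  have FG: "F \<subseteq> G"
    using F vanish by (auto simp: G_def)
  have "affine hull G \<subseteq> {x. b \<bullet> x = 0}"
    by (rule hull_minimal) (auto simp: G_def affine_hyperplane)
  then have "w \<notin> affine hull G"
    using w by auto
  then have "affine hull G \<subset> affine hull Q"
    using hull_mono[of G Q affine] hull_inc[OF w(1), of affine] by (auto simp: G_def)
  then have "aff_dim G < aff_dim Q"
    by (rule aff_dim_psubset)
  with dim have "\<not> aff_dim F < aff_dim G"
    by simp
  then have "affine hull F = affine hull G"
    using aff_dim_psubset[of F G] hull_mono[OF FG, of affine] by blast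
  moreover have "affine hull F \<subseteq> {x. a \<bullet> x = 0}"
    by (rule hull_minimal) (auto simp: F affine_hyperplane)
  ultimately have "G \<subseteq> {x. a \<bullet> x = 0}"
    using hull_subset[of G affine] by auto
  then show ?thesis
    using F FG by (auto simp: G_def)
qed

lemma edge_vector_in_edge_cone:
  assumes "v \<in> edge_vectors E"
  shows "v \<in> edge_cone E"
proof -
  have "(\<Sum>u\<in>edge_vectors E. (if u = v then 1 else 0) *\<^sub>R u) = v"
    using assms by (simp add: if_distrib[of "\<lambda>c. c *\<^sub>R _"] sum.delta finite_edge_vectors cong: if_cong)
  then show ?thesis
    unfolding edge_cone_def
    by (intro CollectI exI[of _ "\<lambda>u. if u = v then 1 else 0"]) auto
qed

lemma inner_edge_vector: "a \<bullet> (axis i 1 + axis j 1) = a $ i + a $ j"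
  for a :: "real ^ 'n::finite"
  by (simp add: inner_add_right inner_axis)

text \<open>A nonnegative combination killed by \<open>a\<close> can have nonzero coefficients only
  at generators killed by \<open>a\<close>.\<close>

lemma vanish_on_edge_cone_face:
  assumes x: "x \<in> edge_cone E" "a \<bullet> x = 0"
    and nonneg: "\<And>v. v \<in> edge_vectors E \<Longrightarrow> 0 \<le> a \<bullet> v"
    and vanish: "\<And>v. v \<in> edge_vectors E \<Longrightarrow> a \<bullet> v = 0 \<Longrightarrow> b \<bullet> v = 0"
  shows "b \<bullet> x = 0"
proof -
  obtain c where c: "x = (\<Sum>v\<in>edge_vectors E. c v *\<^sub>R v)" "\<forall>v\<in>edge_vectors E. 0 \<le> c v"
    using x(1) by (auto simp: edge_cone_def)
  have "(\<Sum>v\<in>edge_vectors E. c v * (a \<bullet> v)) = 0"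
    using x(2) by (simp add: c(1) inner_sum_right)
  then have "\<forall>v\<in>edge_vectors E. c v * (a \<bullet> v) = 0"
    using c(2) nonneg by (subst (asm) sum_nonneg_eq_0_iff) (auto simp: finite_edge_vectors)
  then have "\<forall>v\<in>edge_vectors E. c v * (b \<bullet> v) = 0"
    using vanish by auto
  then show ?thesis
    unfolding c(1) inner_sum_right inner_scaleR_right by (rule sum.neutral)
qed

lemma H_set_eq_hyperplane:
  "H_set E A = {x. (\<chi> i. of_bool (i \<in> neighbours E A) - of_bool (i \<in> A)) \<bullet> x = 0}"
  by (auto simp: H_set_def inner_vec_def algebra_simps sum_subtractf of_bool_def
      if_distrib[of "\<lambda>c. _ * c"] sum.If_cases cong: if_cong)

theorem theorem3p9:
  fixes E :: "'n::finite set set" and F :: "(real ^ 'n) set"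
  assumes "simple_graph E"
    and "cone_facet (edge_cone E) F"
  shows "(\<exists>i. F = edge_cone E \<inter> {x. x $ i = 0}) \<or>
    (\<exists>A. independent_vertices E A \<and> F = edge_cone E \<inter> H_set E A)"
proof -
  obtain a where supp: "edge_cone E \<subseteq> {x. 0 \<le> a \<bullet> x}"
    and F: "F = edge_cone E \<inter> {x. a \<bullet> x = 0}"
    and dim: "aff_dim F = aff_dim (edge_cone E) - 1"
    using assms(2) by (auto simp: cone_facet_def cone_face_def)
  have nonneg: "0 \<le> a \<bullet> v" if "v \<in> edge_vectors E" for v
    using supp edge_vector_in_edge_cone[OF that] by auto
  have edge: "0 \<le> a $ i + a $ j" if "{i, j} \<in> E" for i j
    using nonneg[of "axis i 1 + axis j 1"] that
    by (auto simp: edge_vectors_def inner_edge_vector)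
  have cut: "F = edge_cone E \<inter> {x. b \<bullet> x = 0}"
    if zero: "\<And>i j. {i, j} \<in> E \<Longrightarrow> a $ i + a $ j = 0 \<Longrightarrow> b $ i + b $ j = 0"
      and pq: "{p, q} \<in> E" "b $ p + b $ q \<noteq> 0" for b p q
  proof (rule hyperplane_section_eqI[OF F dim])
    show "b \<bullet> x = 0" if "x \<in> F" for x
    proof (rule vanish_on_edge_cone_face)
      show "x \<in> edge_cone E" "a \<bullet> x = 0"
        using that F by auto
      show "b \<bullet> v = 0" if "v \<in> edge_vectors E" "a \<bullet> v = 0" for v
        using that zero by (auto simp: edge_vectors_def inner_edge_vector)
    qed (rule nonneg)
    show "axis p 1 + axis q 1 \<in> edge_cone E"
      using pq(1) by (intro edge_vector_in_edge_cone) (auto simp: edge_vectors_def)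
    show "b \<bullet> (axis p 1 + axis q 1) \<noteq> 0"
      using pq(2) by (simp add: inner_edge_vector)
  qed
  have "\<exists>p q. {p, q} \<in> E \<and> 0 < a $ p + a $ q"
  proof (rule ccontr)
    assume "\<not> ?thesis"
    then have zero: "a \<bullet> v = 0" if "v \<in> edge_vectors E" for v
      using that edge by (force simp: edge_vectors_def inner_edge_vector)
    \<comment> \<open>With the zero functional in the supporting role, vanishing of \<open>a\<close>
      on the generators spreads to the whole cone.\<close>
    have "F = edge_cone E"
      using F zero vanish_on_edge_cone_face[of _ E 0 a] by auto
    with dim show False
      by simp
  qed
  then obtain p q where pq: "{p, q} \<in> E" "0 < a $ p + a $ q" "0 < a $ q"
    by (metis add_nonpos_nonpos insert_commute add.commute not_le)
  define A where "A = {i. a $ i \<le> - a $ q}"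
  show ?thesis
  proof (cases "q \<in> neighbours E A")
    case False
    then have far: "- a $ q < a $ i" if "{i, q} \<in> E" for i
      using that by (force simp: neighbours_def A_def)
    have "F = edge_cone E \<inter> {x. axis q 1 \<bullet> x = 0}"
    proof (rule cut[OF _ pq(1)])
      fix i j
      assume ij: "{i, j} \<in> E" "a $ i + a $ j = 0"
      \<comment> \<open>An edge at \<open>q\<close> with weight sum 0 would have its other end at
        weight exactly \<open>- a $ q\<close>.\<close>
      then have "i \<noteq> q" "j \<noteq> q"
        using far[of i] far[of j] by (auto simp: insert_commute)
      then show "axis q (1::real) $ i + axis q 1 $ j = 0"
        by (simp add: axis_def)
    qed (auto simp: axis_def)
    then show ?thesis
      by (auto simp: inner_axis')
  next
    case True
    let ?N = "neighbours E A"
    define b :: "real ^ 'n" where "b = (\<chi> i. of_bool (i \<in> ?N) - of_bool (i \<in> A))"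
    have N_pos: "a $ q \<le> a $ j" if "j \<in> ?N" for j
      using that edge by (force simp: neighbours_def A_def)
    have "independent_vertices E A"
      using edge pq(3) by (force simp: independent_vertices_def A_def)
    moreover have "F = edge_cone E \<inter> {x. b \<bullet> x = 0}"
    proof (rule cut[OF _ pq(1)])
      have disj: "j \<notin> A" if "j \<in> ?N" for j
        using N_pos[OF that] pq(3) by (auto simp: A_def)
      have "p \<notin> A"
        using pq(2) by (auto simp: A_def)
      \<comment> \<open>Here \<open>b $ q\<close> is 1 and \<open>b $ p\<close> is 0 or 1.\<close>
      then show "b $ p + b $ q \<noteq> 0"
        using True disj by (auto simp: b_def)
      \<comment> \<open>Opposite weights turn the bound \<open>N_pos\<close> at \<open>j\<close>
        into \<open>a $ i \<le> - a $ q\<close>. Applied in both directions, the equivalence makes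
        the entries of \<open>b\<close> cancel.\<close>
      have match: "i \<in> A \<longleftrightarrow> j \<in> ?N" if "{i, j} \<in> E" "a $ i + a $ j = 0" for i j
      proof
        show "j \<in> ?N" if "i \<in> A"
          using that \<open>{i, j} \<in> E\<close> by (auto simp: neighbours_def)
        show "i \<in> A" if "j \<in> ?N"
          using N_pos[OF that] \<open>a $ i + a $ j = 0\<close> by (simp add: A_def)
      qed
      show "b $ i + b $ j = 0" if "{i, j} \<in> E" "a $ i + a $ j = 0" for i j
        using match[of i j] match[of j i] that
        by (simp add: b_def insert_commute add.commute)
    qed
    ultimately show ?thesis
      by (auto simp: H_set_eq_hyperplane b_def)
  qed
qed

end
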